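(* Under the standing assumptions A1--A4 (see context), let $\bar u\in\operatorname{dom}g$ be given such that $\bar\xi:=-\nabla f(\bar u)\in\partial g(\bar u)$. Let $X\in\{Y,\mathcal U^*\}$ and assume the following. (i) There exists an operator $f''(\bar u):\mathcal U\to Y$ such that $\frac{\nabla f(\bar u+t_nh_n)-\nabla f(\bar u)}{t_n}\to f''(\bar u)h$ in $Y$ for all sequences $(t_n)_n\subset(0,\infty)$, $(h_n)_n\subset\mathcal U$ with $t_n\to0$, $h_n\overset{*}{\rightharpoonup}h$ and $\bar u+t_nh_n\in\operatorname{dom}g$. (ii) There do not exist sequences $(t_n)_n\subset(0,\infty)$, $(h_n)_n\subset\mathcal U$, $(z_n)_n\subset X$ with $t_n\to0$, $h_n\overset{*}{\rightharpoonup}0$, $\|h_n\|_{\mathcal U}=1$, $z_n\to0$ in $X$, and $\bar\xi+t_nz_n\in\partial g(\bar u+t_nh_n)$ for all $n$. (iii) For all sequences $(t_n)_n\subset(0,\infty)$, $(h_n)_n\subset\mathcal U$, $(z_n)_n\subset X$, and all $h\in\mathcal U$, $z\in Y$ with $t_n\to0$, $h_n\overset{*}{\rightharpoonup}h$, $\|h_n\|_{\mathcal U}=1$, $z_n\to z$ in $X$, and $\bar\xi+t_nz_n\in\partial g(\bar u+t_nh_n)$ for all $n$, we have $$\langle z,h\rangle=\lim_{n\to\infty}\langle z_n,h_n\rangle\ge g''(\bar u,-\nabla f(\bar u);h).$$ (iv) The second-order condition $f''(\bar u)h^2+g''(\bar u,-\nabla f(\bar u);h)>0$ holds for all $h\in\mathcal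 U\setminus\{0\}$, where $f''(\bar u)h^2:=\langle f''(\bar u)h,h\rangle$. Then there exist $\nu,R>0$ such that strong metric subregularity holds at $\bar u$ with $X$ and constants $R$, $\nu$, $\eta=\infty$, i.e. $$\|u-\bar u\|_{\mathcal U}\le\frac1\nu\inf\{\|\nabla f(u)+\xi\|_X\mid\xi\in\partial g(u)\cap X\}\qquad\forall u\in\operatorname{dom}g\text{ with }\|u-\bar u\|_{\mathcal U}\le R.$$
   Context: Standing assumptions. (A1) $\mathcal U\cong Y^*$, where $Y$ is a separable Banach space with norm $\|\cdot\|_Y$; $\langle\cdot,\cdot\rangle$ is the pairing between $Y$ and $\mathcal U$, and $\mathcal U$ carries the dual norm $\|u\|_{\mathcal U}=\sup_{\|y\|_Y\le1}\langle y,u\rangle$. (A2) $g:\mathcal U\to[0,\infty]$ is proper, convex and sequentially weak* lower semicontinuous. (A3) $f:\mathcal U\to[0,\infty)$ is sequentially weak* lower semicontinuous on $\operatorname{dom}g$, and there are a neighborhood $\mathcal N$ of $\operatorname{dom}g$ in $\mathcal U$ and a map $\nabla f:\operatorname{dom}g\to Y$ such that $f$ is Gâteaux differentiable on $\mathcal N$ with $f'(u)(\delta u)=\langle\nabla f(u),\delta u\rangle$ for all $u\in\operatorname{dom}g$, $\delta u\in\mathcal U$; moreover there is $L_{\nabla f}\ge0$ with $\|\nabla f(u_1)-\nabla f(u_2)\|_Y\le L_{\nabla f}\|u_1-u_2\|_{\mathcal U}$ for all $u_1,u_2\in\operatorname{dom}g$. (A4) With $J:=f+g$: if $\|u_k\|_{\mathcal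 U}\to\infty$ then $J(u_k)\to\infty$. $\mathcal U^*$ is the dual of $\mathcal U$ with its canonical norm; $Y$ is regarded as a subspace of $\mathcal U^*=Y^{**}$ via the canonical isometric embedding, and $\langle\cdot,\cdot\rangle$ also denotes the pairing of $\mathcal U^*$ with $\mathcal U$. $\partial g(u)\subset\mathcal U^*$ is the convex subdifferential. The infimum over the empty set is $+\infty$. Weak* second subderivative: for $u\in\operatorname{dom}g$, $\xi\in Y$, $h\in\mathcal U$, $$g''(u,\xi;h):=\inf\left\{\liminf_{k\to\infty}\frac{g(u+t_kh_k)-g(u)-t_k\langle\xi,h_k\rangle}{t_k^2/2}\ \middle|\ t_k\searrow0,\ h_k\overset{*}{\rightharpoonup}h\right\}\in[-\infty,\infty].$$ *)

theory Defs
  imports "HOL-Analysis.Analysis"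
begin

text \<open>
  Throughout, \<open>'y\<close> is the predual space Y and \<open>'u\<close> is the space U, which is identified with the
  dual of Y by a bounded linear map \<open>\<Phi> :: 'u \<Rightarrow>\<^sub>L ('y \<Rightarrow>\<^sub>L real)\<close>. The pairing of \<open>y\<close> and \<open>u\<close> is
  \<open>\<Phi> u y\<close>. That \<open>\<Phi>\<close> is a bijective isometry is a hypothesis of the theorem, not of the
  definitions. The dual of U is the type \<open>'u \<Rightarrow>\<^sub>L real\<close>. When \<open>\<Phi>\<close> is a
  bijective isometry, \<open>canonical_embedding \<Phi>\<close> is isometric (Hahn-Banach), so Y as a normed space is
  its range with the norm of \<open>'u \<Rightarrow>\<^sub>L real\<close>.
\<close>

lift_definition canonical_embedding ::
  "('u::real_normed_vector \<Rightarrow>\<^sub>L ('y::real_normed_vector \<Rightarrow>\<^sub>L real)) \<Rightarrow> 'y \<Rightarrow> ('u \<Rightarrow>\<^sub>L real)"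
  is "\<lambda>\<Phi> y u. blinfun_apply (\<Phi> u) y"
  by (intro bounded_linear_intros)

definition weak_star_lim ::
  "('u::real_normed_vector \<Rightarrow>\<^sub>L ('y::real_normed_vector \<Rightarrow>\<^sub>L real)) \<Rightarrow> (nat \<Rightarrow> 'u) \<Rightarrow> 'u \<Rightarrow> bool"
  where "weak_star_lim \<Phi> h l \<longleftrightarrow> (\<forall>y. (\<lambda>n. \<Phi> (h n) y) \<longlonglongrightarrow> \<Phi> l y)"

definition seq_weak_star_lsc_on ::
  "('u::real_normed_vector \<Rightarrow>\<^sub>L ('y::real_normed_vector \<Rightarrow>\<^sub>L real)) \<Rightarrow> 'u set \<Rightarrow> ('u \<Rightarrow> ereal) \<Rightarrow> bool"
  where "seq_weak_star_lsc_on \<Phi> S F \<longleftrightarrow>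
    (\<forall>u l. (\<forall>n. u n \<in> S) \<and> l \<in> S \<and> weak_star_lim \<Phi> u l \<longrightarrow> F l \<le> liminf (\<lambda>n. F (u n)))"

definition eff_dom :: "('u \<Rightarrow> ereal) \<Rightarrow> 'u set"
  where "eff_dom g = {u. g u < \<infinity>}"

text \<open>
  Only used for functions that do not take the value \<open>-\<infinity>\<close>, so that the right-hand side is never
  of the form \<open>\<infinity> - \<infinity>\<close>. At the endpoints of the interval \<open>0 * \<infinity> = 0\<close> makes the inequality hold trivially.
\<close>

definition ereal_convex :: "('u::real_vector \<Rightarrow> ereal) \<Rightarrow> bool"
  where "ereal_convex g \<longleftrightarrow>
    (\<forall>u v. \<forall>s\<in>{0..1}.
      g ((1 - s) *\<^sub>R u + s *\<^sub>R v) \<le> ereal (1 - s) * g u + ereal s * g v)"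

definition has_gateaux_derivative ::
  "('u::real_normed_vector \<Rightarrow> real) \<Rightarrow> ('u \<Rightarrow>\<^sub>L real) \<Rightarrow> 'u \<Rightarrow> bool"
  where "has_gateaux_derivative f A u \<longleftrightarrow>
    (\<forall>d. ((\<lambda>t. (f (u + t *\<^sub>R d) - f u) / t) \<longlongrightarrow> A d) (at 0))"

definition convex_subdifferential ::
  "('u::real_normed_vector \<Rightarrow> ereal) \<Rightarrow> 'u \<Rightarrow> ('u \<Rightarrow>\<^sub>L real) set"
  where "convex_subdifferential g u =
    {\<xi>. u \<in> eff_dom g \<and> (\<forall>v. g u + ereal (blinfun_apply \<xi> (v - u)) \<le> g v)}"

text \<open>
  Meaningful for \<open>u \<in> eff_dom g\<close>, where \<open>g u\<close> is finite and the difference quotient is well-defined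
  in \<open>(-\<infinity>, \<infinity>]\<close>. The sequence \<open>t\<close> is positive and tends to 0 but is not required to be monotone;
  passing to subsequences shows that this does not affect the infimum.
\<close>

definition weak_star_second_subderivative ::
  "('u::real_normed_vector \<Rightarrow>\<^sub>L ('y::real_normed_vector \<Rightarrow>\<^sub>L real)) \<Rightarrow>
    ('u \<Rightarrow> ereal) \<Rightarrow> 'u \<Rightarrow> 'y \<Rightarrow> 'u \<Rightarrow> ereal"
  where "weak_star_second_subderivative \<Phi> g u \<xi> h =
    Inf {liminf (\<lambda>k. (g (u + t k *\<^sub>R hs k) - g u - ereal (t k * \<Phi> (hs k) \<xi>)) / ereal ((t k)\<^sup>2 / 2))
      | t hs. (\<forall>k. t k > 0) \<and> t \<longlonglongrightarrow> 0 \<and> weak_star_lim \<Phi> hs h}"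

end

theory Submission
  imports Defs "HOL-Complex_Analysis.Great_Picard"
begin

text \<open>
  The argument is by contradiction and compactness. If the estimate fails for all constants, there
  are points \<open>u n\<close> tending to \<open>ubar\<close> and subgradients \<open>\<xi> n\<close> of \<open>g\<close> at \<open>u n\<close> lying in \<open>X\<close> whose residuals
  \<open>gradf (u n) + \<xi> n\<close> are of smaller order than the distance \<open>t n = norm (u n - ubar)\<close>. The directions
  \<open>h n = (u n - ubar) / t n\<close> have norm one, so by the sequential Banach-Alaoglu theorem
  (\<open>weak_star_convergent_subsequence\<close>; this is where separability of the predual enters) a
  subsequence converges weakly* to some \<open>h\<close>. The rescaled subgradients split as
  \<open>z n = (\<xi> n - \<xi>bar) / t n = (gradf (u n) + \<xi> n) / t n - (gradf (u n) - gradf ubar) / t n\<close>,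
  where \<open>\<xi>bar = - gradf ubar\<close>. The first part is negligible and the second one is the difference
  quotient from (i), so \<open>z n\<close> converges in norm to \<open>- f2 h\<close>.

  If \<open>h = 0\<close>, then \<open>f2 h = 0\<close>, and the sequences \<open>t\<close>, \<open>h\<close>, \<open>z\<close> are exactly what (ii) excludes. If
  \<open>h \<noteq> 0\<close>, then (iii) bounds the second subderivative at \<open>h\<close> by \<open>- \<Phi> h (f2 h)\<close>, which
  contradicts the second-order condition (iv).
\<close>

section \<open>Sequential weak* compactness\<close>

text \<open>
  The sequential Banach-Alaoglu theorem. A diagonal argument yields convergence on a countable dense
  set, and equicontinuity carries it over to all points. The diagonal lemma wants one bound for all
  points of the countable set, whence the normalisation by \<open>1 + norm x\<close>.
\<close>

lemma bounded_functionals_convergent_subsequence: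
  fixes \<phi> :: "nat \<Rightarrow> ('y::real_normed_vector \<Rightarrow>\<^sub>L real)"
  assumes sep: "separable_space (euclidean :: 'y topology)"
    and bound: "\<And>n. norm (\<phi> n) \<le> M"
  obtains r :: "nat \<Rightarrow> nat" and l :: "'y \<Rightarrow>\<^sub>L real"
    where "strict_mono r" "\<And>y. (\<lambda>n. \<phi> (r n) y) \<longlonglongrightarrow> l y"
proof -
  have apply_le: "\<bar>\<phi> n y\<bar> \<le> M * norm y" for n y
    using norm_blinfun[of "\<phi> n" y] mult_right_mono[OF bound[of n], of "norm y"] by simp
  have M0: "0 \<le> M"
    using bound[of 0] norm_ge_zero order_trans by blast
  obtain C :: "'y set" where C: "countable C" "closure C = UNIV"
    using sep unfolding separable_space_def by (auto simp: euclidean_closure_of)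
  have "norm (\<phi> n x / (1 + norm x)) \<le> M" for n x
  proof -
    have "M * norm x \<le> M * (1 + norm x)"
      using M0 by (intro mult_left_mono) auto
    hence "\<bar>\<phi> n x\<bar> \<le> M * (1 + norm x)"
      using apply_le[of n x] by linarith
    moreover have "0 < 1 + norm x"
      by (simp add: add_pos_nonneg)
    ultimately show ?thesis
      by (simp add: divide_le_eq)
  qed
  then obtain r where r: "strict_mono (r :: nat \<Rightarrow> nat)"
    and conv_C: "\<And>x. x \<in> C \<Longrightarrow> \<exists>l. (\<lambda>n. \<phi> (r n) x / (1 + norm x)) \<longlonglongrightarrow> l"
    using function_convergent_subsequence[OF C(1), of "\<lambda>n x. \<phi> n x / (1 + norm x)" M] by blast
  have Cauchy_C: "Cauchy (\<lambda>n. \<phi> (r n) x)" if x: "x \<in> C" for x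
  proof -
    obtain l where "(\<lambda>n. \<phi> (r n) x / (1 + norm x)) \<longlonglongrightarrow> l"
      using conv_C[OF x] by blast
    hence "(\<lambda>n. \<phi> (r n) x / (1 + norm x) * (1 + norm x)) \<longlonglongrightarrow> l * (1 + norm x)"
      by (intro tendsto_intros)
    moreover have "1 + norm x \<noteq> 0"
      using norm_ge_zero[of x] by linarith
    ultimately show ?thesis
      by (simp add: LIMSEQ_imp_Cauchy)
  qed
  have "Cauchy (\<lambda>n. \<phi> (r n) y)" for y
  proof (rule metric_CauchyI)
    fix e :: real assume e: "0 < e"
    define d where "d = e / (3 * (M + 1))"
    have d: "0 < d" and Md: "M * d < e / 3"
      using e M0 by (auto simp: d_def field_simps)
    obtain x where x: "x \<in> C" "dist x y < d"
      using C(2) d closure_approachable[of y C] by auto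
    have near: "\<bar>\<phi> n x - \<phi> n y\<bar> < e / 3" for n
    proof -
      have "\<bar>\<phi> n x - \<phi> n y\<bar> \<le> M * norm (x - y)"
        using apply_le[of n "x - y"] by (simp add: blinfun.diff_right)
      also have "\<dots> \<le> M * d"
        using x(2) M0 by (intro mult_left_mono) (auto simp: dist_norm)
      finally show ?thesis
        using Md by linarith
    qed
    obtain N where N: "\<forall>m\<ge>N. \<forall>n\<ge>N. dist (\<phi> (r m) x) (\<phi> (r n) x) < e / 3"
      using metric_CauchyD[OF Cauchy_C[OF x(1)], of "e / 3"] e by auto
    have "dist (\<phi> (r m) y) (\<phi> (r n) y) < e" if "m \<ge> N" "n \<ge> N" for m n
      using N[rule_format, OF that] near[of "r m"] near[of "r n"]
      unfolding dist_real_def by linarith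
    thus "\<exists>N. \<forall>m\<ge>N. \<forall>n\<ge>N. dist (\<phi> (r m) y) (\<phi> (r n) y) < e"
      by blast
  qed
  hence lim: "(\<lambda>n. \<phi> (r n) y) \<longlonglongrightarrow> lim (\<lambda>n. \<phi> (r n) y)" for y
    by (simp add: Cauchy_convergent convergent_LIMSEQ_iff[symmetric])
  define l where "l y = lim (\<lambda>n. \<phi> (r n) y)" for y
  have l: "(\<lambda>n. \<phi> (r n) y) \<longlonglongrightarrow> l y" for y
    using lim by (simp add: l_def)
  have "bounded_linear l"
  proof (rule bounded_linear_intro[where K = M])
    show "l (x + y) = l x + l y" for x y
      using tendsto_add[OF l[of x] l[of y]] l[of "x + y"]
      by (intro LIMSEQ_unique[OF l[of "x + y"]]) (simp add: blinfun.add_right)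
    show "l (c *\<^sub>R x) = c *\<^sub>R l x" for c x
      using tendsto_scaleR[OF tendsto_const l[of x], of c]
      by (intro LIMSEQ_unique[OF l[of "c *\<^sub>R x"]]) (simp add: blinfun.scaleR_right)
    show "norm (l x) \<le> norm x * M" for x
      by (rule tendsto_upperbound[OF tendsto_norm[OF l[of x]]])
         (use apply_le in \<open>auto simp: mult.commute\<close>)
  qed
  with l r show thesis
    by (intro that[of r "Blinfun l"]) (auto simp: bounded_linear_Blinfun_apply)
qed

lemma weak_star_convergent_subsequence:
  fixes \<Phi> :: "'u::real_normed_vector \<Rightarrow>\<^sub>L ('y::real_normed_vector \<Rightarrow>\<^sub>L real)"
  assumes "separable_space (euclidean :: 'y topology)"
    and "surj (blinfun_apply \<Phi>)"
    and "\<And>u. norm (\<Phi> u) \<le> norm u"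
    and "\<And>n. norm (h n) \<le> M"
  obtains r :: "nat \<Rightarrow> nat" and l where "strict_mono r" "weak_star_lim \<Phi> (h \<circ> r) l"
proof -
  obtain r \<psi> where r: "strict_mono (r :: nat \<Rightarrow> nat)"
    and \<psi>: "\<And>y. (\<lambda>n. \<Phi> (h (r n)) y) \<longlonglongrightarrow> blinfun_apply \<psi> y"
    using bounded_functionals_convergent_subsequence[OF assms(1), of "\<lambda>n. \<Phi> (h n)" M]
      order_trans[OF assms(3,4)] by blast
  obtain l where "\<psi> = \<Phi> l"
    using assms(2) by (meson surjD)
  with r \<psi> show thesis
    by (intro that[of r l]) (auto simp: weak_star_lim_def)
qed

section \<open>The canonical embedding of the predual\<close>

lemma canonical_embedding_add:
  "canonical_embedding \<Phi> (x + y) = canonical_embedding \<Phi> x + canonical_embedding \<Phi> y"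
  by (rule blinfun_eqI) (simp add: canonical_embedding.rep_eq blinfun.add_left blinfun.add_right)

lemma canonical_embedding_scaleR:
  "canonical_embedding \<Phi> (c *\<^sub>R x) = c *\<^sub>R canonical_embedding \<Phi> x"
  by (rule blinfun_eqI)
     (simp add: canonical_embedding.rep_eq blinfun.scaleR_left blinfun.scaleR_right)

text \<open>
  Continuity of the embedding is what turns the convergence of the difference quotients of \<open>gradf\<close>
  in the predual, given by (i), into norm convergence in the dual space that contains the
  subgradients.
\<close>

lemma bounded_linear_canonical_embedding: "bounded_linear (canonical_embedding \<Phi>)"
proof (rule bounded_linear_intro[where K = "norm \<Phi>"])
  show "norm (canonical_embedding \<Phi> y) \<le> norm y * norm \<Phi>" for y
  proof (rule norm_blinfun_bound)
    fix u
    have "norm (\<Phi> u y) \<le> norm (\<Phi> u) * norm y"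
      by (rule norm_blinfun)
    also have "\<dots> \<le> norm \<Phi> * norm u * norm y"
      by (intro mult_right_mono norm_blinfun) auto
    finally show "norm (canonical_embedding \<Phi> y u) \<le> norm y * norm \<Phi> * norm u"
      by (simp add: canonical_embedding.rep_eq mult_ac)
  qed auto
qed (simp_all add: canonical_embedding_add canonical_embedding_scaleR)

section \<open>Strong metric subregularity\<close>

text \<open>
  This turns a failure of the subregularity estimate into an actual subgradient. The infimum is
  infinite if the set is empty; a bound by a finite number excludes that case.
\<close>

lemma less_from_mult_Inf:
  fixes a c :: real
  assumes "ereal c * Inf {ereal (F x) |x. P x} < ereal a" "0 < c"
  obtains x where "P x" "c * F x < a"
proof (rule ccontr)
  assume "\<not> thesis"
  hence "a \<le> c * F x" if "P x" for x
    using that not_le \<open>\<And>x. P x \<Longrightarrow> c * F x < a \<Longrightarrow> thesis\<close> by blast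
  hence "ereal (a / c) \<le> Inf {ereal (F x) |x. P x}"
    using assms(2) by (intro Inf_greatest) (auto simp: divide_le_eq mult.commute)
  hence "ereal c * ereal (a / c) \<le> ereal c * Inf {ereal (F x) |x. P x}"
    using assms(2) by (intro ereal_mult_left_mono) auto
  with assms show False
    by simp
qed

theorem theorem6p11:
  fixes \<Phi> :: "'u::real_normed_vector \<Rightarrow>\<^sub>L ('y::banach \<Rightarrow>\<^sub>L real)"
    and f :: "'u \<Rightarrow> real"
    and g :: "'u \<Rightarrow> ereal"
    and gradf :: "'u \<Rightarrow> 'y"
    and ubar :: 'u
    and X :: "('u \<Rightarrow>\<^sub>L real) set"
    and f2 :: "'u \<Rightarrow> 'y"
  assumes A1_separable: "separable_space (euclidean :: 'y topology)"
    and A1_bij: "bij (blinfun_apply \<Phi>)"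
    and A1_norm: "\<And>u. norm (\<Phi> u) = norm u"
    and A2_nonneg: "\<And>u. 0 \<le> g u"
    and A2_proper: "eff_dom g \<noteq> {}"
    and A2_convex: "ereal_convex g"
    and A2_lsc: "seq_weak_star_lsc_on \<Phi> UNIV g"
    and A3_nonneg: "\<And>u. 0 \<le> f u"
    and A3_lsc: "seq_weak_star_lsc_on \<Phi> (eff_dom g) (\<lambda>u. ereal (f u))"
    and A3_gateaux: "\<exists>N. eff_dom g \<subseteq> interior N \<and> (\<forall>u\<in>N. \<exists>A. has_gateaux_derivative f A u)"
    and A3_gradient:
      "\<And>u. u \<in> eff_dom g \<Longrightarrow> has_gateaux_derivative f (canonical_embedding \<Phi> (gradf u)) u"
    and A3_lipschitz: "\<exists>L\<ge>0. L-lipschitz_on (eff_dom g) gradf"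
    and A4_coercive:
      "\<And>u :: nat \<Rightarrow> 'u. filterlim (\<lambda>k. norm (u k)) at_top sequentially \<Longrightarrow>
        (\<lambda>k. ereal (f (u k)) + g (u k)) \<longlonglongrightarrow> \<infinity>"
    and ubar_dom: "ubar \<in> eff_dom g"
    and ubar_stationary:
      "canonical_embedding \<Phi> (- gradf ubar) \<in> convex_subdifferential g ubar"
    and X_cases: "X \<in> {range (canonical_embedding \<Phi>), UNIV}"
    and i: "\<And>t h hlim. \<lbrakk>\<forall>n. t n > 0; t \<longlonglongrightarrow> 0; weak_star_lim \<Phi> h hlim;
        \<forall>n. ubar + t n *\<^sub>R h n \<in> eff_dom g\<rbrakk> \<Longrightarrow>
        (\<lambda>n. (gradf (ubar + t n *\<^sub>R h n) - gradf ubar) /\<^sub>R t n) \<longlonglongrightarrow> f2 hlim"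
    and ii: "\<not> (\<exists>t h z. (\<forall>n. t n > 0) \<and> t \<longlonglongrightarrow> 0 \<and> weak_star_lim \<Phi> h 0 \<and> (\<forall>n. norm (h n) = 1)
        \<and> (\<forall>n. z n \<in> X) \<and> z \<longlonglongrightarrow> 0
        \<and> (\<forall>n. canonical_embedding \<Phi> (- gradf ubar) + t n *\<^sub>R z n
              \<in> convex_subdifferential g (ubar + t n *\<^sub>R h n)))"
    and iii: "\<And>t h z hlim zlim. \<lbrakk>\<forall>n. t n > 0; t \<longlonglongrightarrow> 0; weak_star_lim \<Phi> h hlim; \<forall>n. norm (h n) = 1;
        \<forall>n. z n \<in> X; z \<longlonglongrightarrow> canonical_embedding \<Phi> zlim;
        \<forall>n. canonical_embedding \<Phi> (- gradf ubar) + t n *\<^sub>R z n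
              \<in> convex_subdifferential g (ubar + t n *\<^sub>R h n)\<rbrakk> \<Longrightarrow>
        (\<lambda>n. blinfun_apply (z n) (h n)) \<longlonglongrightarrow> \<Phi> hlim zlim \<and>
        weak_star_second_subderivative \<Phi> g ubar (- gradf ubar) hlim \<le> ereal (\<Phi> hlim zlim)"
    and iv: "\<And>h. h \<noteq> 0 \<Longrightarrow>
        ereal (\<Phi> h (f2 h)) + weak_star_second_subderivative \<Phi> g ubar (- gradf ubar) h > 0"
  shows "\<exists>\<nu>>0. \<exists>R>0. \<forall>u\<in>eff_dom g. norm (u - ubar) \<le> R \<longrightarrow>
    ereal (norm (u - ubar)) \<le>
      ereal (1 / \<nu>) * Inf {ereal (norm (canonical_embedding \<Phi> (gradf u) + \<xi>))
                          | \<xi>. \<xi> \<in> convex_subdifferential g u \<inter> X}"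
proof (rule ccontr)
  let ?E = "canonical_embedding \<Phi>"
  note E = bounded_linear_canonical_embedding[of \<Phi>]
  note E_lin = bounded_linear.linear[OF E]
  assume neg: "\<not> ?thesis"
  \<comment> \<open>The constants \<open>\<nu> = R = 1 / (n + 1)\<close> fail for every \<open>n\<close>.\<close>
  have "\<exists>u \<xi>. u \<in> eff_dom g \<and> norm (u - ubar) \<le> 1 / real (Suc n)
      \<and> \<xi> \<in> convex_subdifferential g u \<inter> X
      \<and> real (Suc n) * norm (?E (gradf u) + \<xi>) < norm (u - ubar)" for n
  proof -
    have pos: "1 / real (Suc n) > 0"
      by simp
    obtain u where u: "u \<in> eff_dom g" "norm (u - ubar) \<le> 1 / real (Suc n)"
      and less: "ereal (real (Suc n)) * Inf {ereal (norm (?E (gradf u) + \<xi>))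
          |\<xi>. \<xi> \<in> convex_subdifferential g u \<inter> X} < ereal (norm (u - ubar))"
      using neg pos by (auto simp del: of_nat_Suc simp: not_le dest!: spec[of _ "1 / real (Suc n)"])
    show ?thesis
      by (rule less_from_mult_Inf[OF less]) (use u in auto)
  qed
  then obtain u \<xi> where u: "\<And>n. u n \<in> eff_dom g" "\<And>n. norm (u n - ubar) \<le> 1 / real (Suc n)"
    and \<xi>: "\<And>n. \<xi> n \<in> convex_subdifferential g (u n)" "\<And>n. \<xi> n \<in> X"
    and res: "\<And>n. real (Suc n) * norm (?E (gradf (u n)) + \<xi> n) < norm (u n - ubar)"
    by (metis IntD1 IntD2)
  define t where "t n = norm (u n - ubar)" for n
  define h where "h n = (u n - ubar) /\<^sub>R t n" for n
  define z where "z n = (\<xi> n + ?E (gradf ubar)) /\<^sub>R t n" for n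
  have t_pos: "t n > 0" for n
    using le_less_trans[OF _ res[of n], of 0] by (simp add: t_def)
  have t_lim: "t \<longlonglongrightarrow> 0"
    by (rule real_tendsto_sandwich[OF _ _ tendsto_const LIMSEQ_inverse_real_of_nat])
       (use t_pos u(2) in \<open>auto simp: t_def inverse_eq_divide less_imp_le\<close>)
  have h_norm: "norm (h n) = 1" for n
    using t_pos[of n] by (simp add: h_def t_def)
  have u_eq: "ubar + t n *\<^sub>R h n = u n" for n
    using t_pos[of n] by (simp add: h_def)
  have \<xi>_eq: "?E (- gradf ubar) + t n *\<^sub>R z n = \<xi> n" for n
    using t_pos[of n] by (simp add: z_def linear_neg[OF E_lin])
  have "subspace X"
    using X_cases by (auto simp: linear_subspace_image E_lin subspace_UNIV)
  moreover have "?E (gradf ubar) \<in> X"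
    using X_cases by auto
  ultimately have z_X: "z n \<in> X" for n
    using \<xi>(2) by (auto simp: z_def intro: subspace_add subspace_scale)

  obtain r hlim where r: "strict_mono (r :: nat \<Rightarrow> nat)" and h_lim: "weak_star_lim \<Phi> (h \<circ> r) hlim"
    using weak_star_convergent_subsequence[OF A1_separable bij_is_surj[OF A1_bij], of h 1]
      A1_norm h_norm by auto
  have tr_lim: "(t \<circ> r) \<longlonglongrightarrow> 0"
    using LIMSEQ_subseq_LIMSEQ[OF t_lim r] .
  have "(\<lambda>n. (gradf (u (r n)) - gradf ubar) /\<^sub>R t (r n)) \<longlonglongrightarrow> f2 hlim"
    using i[of "t \<circ> r" "h \<circ> r" hlim] t_pos tr_lim h_lim u(1) by (simp add: u_eq)
  hence quot: "(\<lambda>n. ?E ((gradf (u (r n)) - gradf ubar) /\<^sub>R t (r n))) \<longlonglongrightarrow> ?E (f2 hlim)"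
    by (rule bounded_linear.tendsto[OF E])
  have "(\<lambda>n. (?E (gradf (u n)) + \<xi> n) /\<^sub>R t n) \<longlonglongrightarrow> 0"
  proof (rule Lim_null_comparison[OF _ LIMSEQ_inverse_real_of_nat], rule always_eventually, rule allI)
    fix n
    have "norm ((?E (gradf (u n)) + \<xi> n) /\<^sub>R t n) = norm (?E (gradf (u n)) + \<xi> n) / t n"
      unfolding norm_scaleR using t_pos[of n] by (simp add: divide_inverse_commute)
    also have "\<dots> \<le> inverse (real (Suc n))"
      using res[of n] t_pos[of n]
      by (simp add: t_def[symmetric] field_simps del: of_nat_Suc)
    finally show "norm ((?E (gradf (u n)) + \<xi> n) /\<^sub>R t n) \<le> inverse (real (Suc n))" .
  qed
  hence residual: "(\<lambda>n. (?E (gradf (u (r n))) + \<xi> (r n)) /\<^sub>R t (r n)) \<longlonglongrightarrow> 0"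
    using LIMSEQ_subseq_LIMSEQ[OF _ r] by (auto simp: o_def)
  have "z n = (?E (gradf (u n)) + \<xi> n) /\<^sub>R t n - ?E ((gradf (u n) - gradf ubar) /\<^sub>R t n)" for n
    by (simp add: z_def canonical_embedding_scaleR linear_diff[OF E_lin]
        scaleR_right_diff_distrib scaleR_right_distrib)
  hence z_lim: "(z \<circ> r) \<longlonglongrightarrow> ?E (- f2 hlim)"
    using tendsto_diff[OF residual quot] by (simp add: o_def linear_neg[OF E_lin])
  have incl: "\<forall>n. ?E (- gradf ubar) + (t \<circ> r) n *\<^sub>R (z \<circ> r) n
      \<in> convex_subdifferential g (ubar + (t \<circ> r) n *\<^sub>R (h \<circ> r) n)"
    using \<xi>(1) by (simp add: \<xi>_eq u_eq)
  have t_pos': "\<forall>n. (t \<circ> r) n > 0" and h_norm': "\<forall>n. norm ((h \<circ> r) n) = 1"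
    and z_X': "\<forall>n. (z \<circ> r) n \<in> X"
    using t_pos h_norm z_X by auto
  show False
  proof (cases "hlim = 0")
    case True
    \<comment> \<open>The zero direction is admissible in (i), and its difference quotients all vanish.\<close>
    have "(\<lambda>n. (gradf (ubar + t n *\<^sub>R 0) - gradf ubar) /\<^sub>R t n) \<longlonglongrightarrow> f2 0"
      using t_pos t_lim ubar_dom by (intro i) (auto simp: weak_star_lim_def)
    hence "f2 0 = 0"
      by (simp add: LIMSEQ_const_iff)
    hence "(z \<circ> r) \<longlonglongrightarrow> 0"
      using z_lim True by (simp add: linear_0[OF E_lin])
    thus False
      using ii t_pos' tr_lim h_lim h_norm' z_X' incl True by blast
  next
    case False
    have "weak_star_second_subderivative \<Phi> g ubar (- gradf ubar) hlim \<le> ereal (\<Phi> hlim (- f2 hlim))"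
      using iii[OF t_pos' tr_lim h_lim h_norm' z_X' z_lim incl] by blast
    hence "ereal (\<Phi> hlim (f2 hlim)) + weak_star_second_subderivative \<Phi> g ubar (- gradf ubar) hlim
        \<le> ereal (\<Phi> hlim (f2 hlim)) + ereal (\<Phi> hlim (- f2 hlim))"
      by (rule add_left_mono)
    also have "\<dots> = 0"
      by (simp add: blinfun.minus_right)
    finally show False
      using iv[OF False] by (simp add: not_le[symmetric])
  qed
qed

end
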